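(* Let $X$ be a $T_0$ space. Then the following conditions are equivalent: (1) $X$ is well-filtered. (2) $\mathsf{WD}(X)=\mathcal S_c(X)$. (3) $\mathsf{RD}(X)=\mathcal S_c(X)$.
   Context: $\mathcal S_c(X)=\{\overline{\{x\}}:x\in X\}$. A set is saturated if it is an intersection of open sets; $\mathsf{K}(X)$ is the set of all nonempty compact saturated subsets of $X$. A family $\mathcal K\subseteq\mathsf{K}(X)$ is filtered if it is nonempty and any two members contain a common third member. $X$ is well-filtered if it is $T_0$ and for every open $U$ and every filtered $\mathcal K\subseteq\mathsf{K}(X)$, $\bigcap\mathcal K\subseteq U$ implies $K\subseteq U$ for some $K\in\mathcal K$. $\mathsf{RD}(X)$ is the set of nonempty closed subsets $A$ of $X$ for which there is a filtered family $\mathcal K\subseteq\mathsf{K}(X)$ such that $A$ is minimal (under inclusion) among the closed sets meeting every member of $\mathcal K$. $\mathsf{WD}(X)$ is the set of closed subsets $A$ of $X$ such that for every continuous map $f:X\to Y$ into a well-filtered space $Y$ there is a unique $y\in Y$ with $\overline{f(A)}=\overline{\{y\}}$. *)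

theory Defs
  imports "HOL-Analysis.Analysis"
begin

definition saturatedin :: "'a topology \<Rightarrow> 'a set \<Rightarrow> bool" where
  "saturatedin X S \<longleftrightarrow> (\<exists>\<U>. (\<forall>U\<in>\<U>. openin X U) \<and> S = topspace X \<inter> \<Inter>\<U>)"

definition compact_saturated_sets :: "'a topology \<Rightarrow> 'a set set" where
  "compact_saturated_sets X = {K. K \<noteq> {} \<and> compactin X K \<and> saturatedin X K}"

definition filtered_family :: "'a set set \<Rightarrow> bool" where
  "filtered_family \<K> \<longleftrightarrow>
     \<K> \<noteq> {} \<and> (\<forall>K1\<in>\<K>. \<forall>K2\<in>\<K>. \<exists>K3\<in>\<K>. K3 \<subseteq> K1 \<and> K3 \<subseteq> K2)"

definition well_filtered_space :: "'a topology \<Rightarrow> bool" where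
  "well_filtered_space X \<longleftrightarrow> t0_space X \<and>
     (\<forall>U \<K>. openin X U \<and> \<K> \<subseteq> compact_saturated_sets X \<and> filtered_family \<K> \<and> \<Inter>\<K> \<subseteq> U
        \<longrightarrow> (\<exists>K\<in>\<K>. K \<subseteq> U))"

definition point_closures :: "'a topology \<Rightarrow> 'a set set" where
  "point_closures X = {X closure_of {x} |x. x \<in> topspace X}"

definition closed_meeting :: "'a topology \<Rightarrow> 'a set set \<Rightarrow> 'a set \<Rightarrow> bool" where
  "closed_meeting X \<K> A \<longleftrightarrow> closedin X A \<and> (\<forall>K\<in>\<K>. A \<inter> K \<noteq> {})"

definition RD :: "'a topology \<Rightarrow> 'a set set" where
  "RD X = {A. A \<noteq> {} \<and> closedin X A \<and>
     (\<exists>\<K>. \<K> \<subseteq> compact_saturated_sets X \<and> filtered_family \<K> \<and>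
        closed_meeting X \<K> A \<and> (\<forall>B. closed_meeting X \<K> B \<and> B \<subseteq> A \<longrightarrow> B = A))}"

text \<open>
  A HOL definition cannot quantify over target spaces of all types, so the targets below
  have points of type \<^typ>\<open>'a set\<close>.  This is no restriction: by \<open>WD_universal\<close>, members of
  \<open>WD X\<close> have the defining property for well-filtered targets of every type.
\<close>

definition WD :: "'a topology \<Rightarrow> 'a set set" where
  "WD X = {A. closedin X A \<and>
     (\<forall>(Y :: 'a set topology) f. well_filtered_space Y \<and> continuous_map X Y f \<longrightarrow>
        (\<exists>!y. y \<in> topspace Y \<and> Y closure_of (f ` A) = Y closure_of {y}))}"

lemma in_closure_of_sing:
  "x \<in> X closure_of {y} \<longleftrightarrow> x \<in> topspace X \<and> (\<forall>T. openin X T \<and> x \<in> T \<longrightarrow> y \<in> T)"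
  by (auto simp: closure_of_def)

lemma exists_minimal_closed_meeting:
  assumes comp: "\<And>K. K \<in> \<L> \<Longrightarrow> compactin X K"
    and D: "closed_meeting X \<L> D"
  obtains C where "closed_meeting X \<L> C" "C \<subseteq> D"
    "\<And>B. closed_meeting X \<L> B \<Longrightarrow> B \<subseteq> C \<Longrightarrow> B = C"
proof -
  define \<A> where "\<A> = {U. U \<subseteq> topspace X \<and> closed_meeting X \<L> (topspace X - U) \<and> topspace X - U \<subseteq> D}"
  have DX: "D \<subseteq> topspace X"
    using D closedin_subset by (auto simp: closed_meeting_def)
  have ne: "\<A> \<noteq> {}"
  proof -
    have "topspace X - (topspace X - D) = D"
      using DX by blast
    then have "topspace X - D \<in> \<A>"
      using D by (auto simp: \<A>_def)
    then show ?thesis by blast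
  qed
  have ch: "\<Union>\<C> \<in> \<A>" if C: "\<C> \<noteq> {}" "subset.chain \<A> \<C>" for \<C>
  proof -
    have sub: "\<C> \<subseteq> \<A>" and lin: "\<And>U V. U \<in> \<C> \<Longrightarrow> V \<in> \<C> \<Longrightarrow> U \<subseteq> V \<or> V \<subseteq> U"
      using C(2) by (auto simp: subset.chain_def subset_chain_def)
    have op: "openin X U" if "U \<in> \<C>" for U
      using that sub by (force simp: \<A>_def closed_meeting_def openin_closedin_eq)
    have meet: "(topspace X - \<Union>\<C>) \<inter> K \<noteq> {}" if K: "K \<in> \<L>" for K
    proof
      assume "(topspace X - \<Union>\<C>) \<inter> K = {}"
      with comp[OF K] have "K \<subseteq> \<Union>\<C>"
        by (auto simp: compactin_def)
      then obtain \<F> where F: "finite \<F>" "\<F> \<subseteq> \<C>" "K \<subseteq> \<Union>\<F>"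
        using comp[OF K] op unfolding compactin_def by meson
      have "K \<noteq> {}"
        using D K by (auto simp: closed_meeting_def)
      then have Fne: "\<F> \<noteq> {}"
        using F by auto
      have "\<Union>\<F> \<in> \<C>"
      proof -
        have "subset.chain \<C> \<F>"
          using F(2) lin by (auto simp: subset_chain_def)
        then have "\<Union>\<F> \<in> \<F>"
          using Union_in_chain[OF F(1) Fne] by blast
        then show ?thesis
          using F by blast
      qed
      then have "closed_meeting X \<L> (topspace X - \<Union>\<F>)"
        using sub by (auto simp: \<A>_def)
      then show False
        using K F(3) by (auto simp: closed_meeting_def)
    qed
    have "openin X (\<Union>\<C>)"
      using op by blast
    then have "closed_meeting X \<L> (topspace X - \<Union>\<C>)"
      using meet by (auto simp: closed_meeting_def)
    moreover have "\<Union>\<C> \<subseteq> topspace X"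
      using sub by (auto simp: \<A>_def)
    moreover have "topspace X - \<Union>\<C> \<subseteq> D"
      using sub C(1) by (auto simp: \<A>_def)
    ultimately show ?thesis
      by (simp add: \<A>_def)
  qed
  obtain M where M: "M \<in> \<A>" "\<forall>V\<in>\<A>. M \<subseteq> V \<longrightarrow> V = M"
    using subset_Zorn_nonempty[OF ne ch] by blast
  show ?thesis
  proof (rule that[of "topspace X - M"])
    show "closed_meeting X \<L> (topspace X - M)" "topspace X - M \<subseteq> D"
      using M by (auto simp: \<A>_def)
    fix B
    assume B: "closed_meeting X \<L> B" "B \<subseteq> topspace X - M"
    have e: "topspace X - (topspace X - B) = B"
      using B(2) by blast
    have "topspace X - B \<in> \<A>"
      using B M(1) by (auto simp: \<A>_def e)
    moreover have "M \<subseteq> topspace X - B"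
      using B M(1) by (auto simp: \<A>_def)
    ultimately have "topspace X - B = M"
      using M(2) by blast
    with e show "B = topspace X - M" by blast
  qed
qed

lemma compact_saturated_upclosure:
  assumes K: "compactin X K" "K \<noteq> {}"
  shows "{y \<in> topspace X. \<exists>b\<in>K. b \<in> X closure_of {y}} \<in> compact_saturated_sets X" (is "?S \<in> _")
proof -
  have KX: "K \<subseteq> topspace X"
    using K by (simp add: compactin_subset_topspace)
  have KS: "K \<subseteq> ?S"
    using KX by (auto simp: in_closure_of_sing)
  have up: "?S \<subseteq> U" if "openin X U" "K \<subseteq> U" for U
    using that by (auto simp: in_closure_of_sing)
  have "compactin X ?S"
    unfolding compactin_def
  proof (intro conjI allI impI)
    fix \<U> assume U: "(\<forall>U\<in>\<U>. openin X U) \<and> ?S \<subseteq> \<Union>\<U>"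
    then obtain \<F> where F: "finite \<F>" "\<F> \<subseteq> \<U>" "K \<subseteq> \<Union>\<F>"
      using K KS unfolding compactin_def by (meson order_trans)
    moreover have "openin X (\<Union>\<F>)"
      using U F by blast
    ultimately show "\<exists>\<F>. finite \<F> \<and> \<F> \<subseteq> \<U> \<and> ?S \<subseteq> \<Union>\<F>"
      using up by meson
  qed auto
  moreover have "saturatedin X ?S"
    unfolding saturatedin_def
  proof (intro exI conjI)
    show "\<forall>U\<in>{U. openin X U \<and> ?S \<subseteq> U}. openin X U" by blast
    have "y \<in> ?S" if y: "y \<in> topspace X" "y \<in> \<Inter>{U. openin X U \<and> ?S \<subseteq> U}" for y
    proof (rule ccontr)
      assume "y \<notin> ?S"
      then have "K \<subseteq> topspace X - X closure_of {y}"
        using y(1) KX by blast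
      moreover have "openin X (topspace X - X closure_of {y})"
        by (simp add: openin_diff)
      ultimately have "topspace X - X closure_of {y} \<in> {U. openin X U \<and> ?S \<subseteq> U}"
        using up by simp
      then have "y \<in> topspace X - X closure_of {y}"
        using y(2) by (rule InterD[rotated])
      then show False
        using y(1) by (auto simp: in_closure_of_sing)
    qed
    then show "?S = topspace X \<inter> \<Inter>{U. openin X U \<and> ?S \<subseteq> U}"
      by (intro equalityI subsetI IntI InterI) auto
  qed
  ultimately show ?thesis
    using KS K(2) unfolding compact_saturated_sets_def by blast
qed

text \<open>The hypothesis \<open>skula\<close> says that the image is closed in the Skula (or \<open>b\<close>-) topology.\<close>

lemma well_filtered_space_pullback:
  fixes h :: "'b \<Rightarrow> 'c"
  assumes Y: "well_filtered_space Y" and hS: "h ` S \<subseteq> topspace Y" and inj: "inj_on h S"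
    and skula: "\<And>y. y \<in> topspace Y \<Longrightarrow> y \<in> Y closure_of (h ` S \<inter> Y closure_of {y}) \<Longrightarrow> y \<in> h ` S"
  shows "well_filtered_space (pullback_topology S h Y)" (is "well_filtered_space ?W")
proof -
  have topW: "topspace ?W = S"
    using hS by (auto simp: topspace_pullback_topology)
  have cont: "continuous_map ?W Y h"
    using hS by (force simp: continuous_map_def openin_pullback_topology topW)
  have t0Y: "t0_space Y"
    using Y by (simp add: well_filtered_space_def)
  have "t0_space ?W"
    unfolding t0_space_def topW
  proof (intro ballI impI)
    fix x y assume xy: "x \<in> S" "y \<in> S" "x \<noteq> y"
    then have "h x \<noteq> h y" "h x \<in> topspace Y" "h y \<in> topspace Y"
      using inj hS by (auto dest: inj_onD)
    then obtain U where "openin Y U" "h x \<notin> U \<longleftrightarrow> h y \<in> U"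
      using t0Y unfolding t0_space_def by blast
    then show "\<exists>U. openin ?W U \<and> (x \<notin> U \<longleftrightarrow> y \<in> U)"
      using xy by (intro exI[of _ "h -` U \<inter> S"]) (auto simp: openin_pullback_topology)
  qed
  moreover have "\<exists>K\<in>\<K>. K \<subseteq> U"
    if U: "openin ?W U" and KW: "\<K> \<subseteq> compact_saturated_sets ?W"
      and filt: "filtered_family \<K>" and int: "\<Inter>\<K> \<subseteq> U" for U \<K>
  proof (rule ccontr)
    assume neg: "\<not> (\<exists>K\<in>\<K>. K \<subseteq> U)"
    obtain V where V: "openin Y V" "U = h -` V \<inter> S"
      using U by (auto simp: openin_pullback_topology)
    have KS: "K \<subseteq> S" if "K \<in> \<K>" for K
      using that KW topW by (auto simp: compact_saturated_sets_def dest: compactin_subset_topspace)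
    define \<L> where "\<L> = (\<lambda>K. h ` K) ` \<K>"
    have comp: "compactin Y L" if "L \<in> \<L>" for L
      using that KW cont by (auto simp: \<L>_def compact_saturated_sets_def intro: image_compactin)
    have D: "closed_meeting Y \<L> (topspace Y - V)"
      unfolding closed_meeting_def
    proof (intro conjI ballI)
      show "closedin Y (topspace Y - V)"
        using V by blast
      fix L assume "L \<in> \<L>"
      then obtain K where K: "K \<in> \<K>" "L = h ` K"
        by (auto simp: \<L>_def)
      then obtain k where "k \<in> K" "k \<notin> U"
        using neg by blast
      then show "(topspace Y - V) \<inter> L \<noteq> {}"
        using K KS[OF K(1)] V hS by auto
    qed
    obtain C where C: "closed_meeting Y \<L> C" "C \<subseteq> topspace Y - V"
      and Cmin: "\<And>B. closed_meeting Y \<L> B \<Longrightarrow> B \<subseteq> C \<Longrightarrow> B = C"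
      using exists_minimal_closed_meeting[OF comp D] by metis
    have clC: "closedin Y C"
      using C by (simp add: closed_meeting_def)
    define up where "up B = {y \<in> topspace Y. \<exists>b\<in>B. b \<in> Y closure_of {y}}" for B
    define \<G> where "\<G> = (\<lambda>K. up (h ` K \<inter> C)) ` \<K>"
    have upC: "up (h ` K \<inter> C) \<in> compact_saturated_sets Y" if "K \<in> \<K>" for K
    proof -
      have "h ` K \<in> \<L>"
        using that by (auto simp: \<L>_def)
      then have "compactin Y (h ` K \<inter> C)" "h ` K \<inter> C \<noteq> {}"
        using comp clC C by (auto simp: closed_meeting_def compact_Int_closedin)
      then show ?thesis
        unfolding up_def by (rule compact_saturated_upclosure)
    qed
    have filtG: "filtered_family \<G>"
      unfolding filtered_family_def
    proof (intro conjI ballI)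
      show "\<G> \<noteq> {}"
        using filt by (auto simp: \<G>_def filtered_family_def)
      fix G1 G2 assume "G1 \<in> \<G>" "G2 \<in> \<G>"
      then obtain K1 K2 where K: "K1 \<in> \<K>" "K2 \<in> \<K>" "G1 = up (h ` K1 \<inter> C)" "G2 = up (h ` K2 \<inter> C)"
        by (auto simp: \<G>_def)
      then obtain K3 where K3: "K3 \<in> \<K>" "K3 \<subseteq> K1" "K3 \<subseteq> K2"
        using filt unfolding filtered_family_def by meson
      have "up (h ` K3 \<inter> C) \<subseteq> G1 \<and> up (h ` K3 \<inter> C) \<subseteq> G2"
        using K3 K by (auto simp: up_def)
      then show "\<exists>G3\<in>\<G>. G3 \<subseteq> G1 \<and> G3 \<subseteq> G2"
        using K3 by (auto simp: \<G>_def)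
    qed
    have "\<not> \<Inter>\<G> \<subseteq> topspace Y - C"
    proof
      assume "\<Inter>\<G> \<subseteq> topspace Y - C"
      moreover have "openin Y (topspace Y - C)"
        using clC by blast
      moreover have "\<G> \<subseteq> compact_saturated_sets Y"
        using upC by (auto simp: \<G>_def)
      ultimately obtain G where "G \<in> \<G>" "G \<subseteq> topspace Y - C"
        using Y filtG unfolding well_filtered_space_def by meson
      then obtain K where K: "K \<in> \<K>" "up (h ` K \<inter> C) \<subseteq> topspace Y - C"
        by (auto simp: \<G>_def)
      obtain b where b: "b \<in> h ` K \<inter> C"
        using K(1) C(1) unfolding closed_meeting_def \<L>_def by blast
      then have "b \<in> up (h ` K \<inter> C)"
        using closedin_subset[OF clC] by (auto simp: up_def in_closure_of_sing)
      then show False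
        using K b by blast
    qed
    moreover have "\<Inter>\<G> \<subseteq> topspace Y"
      using filt by (auto simp: \<G>_def up_def filtered_family_def)
    ultimately obtain c where c: "c \<in> \<Inter>\<G>" "c \<in> C"
      by blast
    have cY: "c \<in> topspace Y"
      using c clC closedin_subset by blast
    have below: "\<exists>k\<in>K. h k \<in> Y closure_of {c}" if "K \<in> \<K>" for K
      using c that by (auto simp: \<G>_def up_def)
    have cC: "Y closure_of {c} = C"
    proof (rule Cmin)
      show "closed_meeting Y \<L> (Y closure_of {c})"
        using below by (fastforce simp: closed_meeting_def \<L>_def)
      show "Y closure_of {c} \<subseteq> C"
        using c clC by (simp add: closure_of_minimal)
    qed
    have "Y closure_of (h ` S \<inter> C) = C"
    proof (rule Cmin)
      have *: "h ` S \<inter> C \<subseteq> Y closure_of (h ` S \<inter> C)"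
        using hS by (intro closure_of_subset) auto
      show "closed_meeting Y \<L> (Y closure_of (h ` S \<inter> C))"
        unfolding closed_meeting_def
      proof (intro conjI ballI)
        fix L assume "L \<in> \<L>"
        then obtain K where K: "K \<in> \<K>" "L = h ` K"
          by (auto simp: \<L>_def)
        obtain k where "k \<in> K" "h k \<in> C"
          using below[OF K(1)] cC by auto
        then show "Y closure_of (h ` S \<inter> C) \<inter> L \<noteq> {}"
          using * K KS[OF K(1)] by blast
      qed auto
      show "Y closure_of (h ` S \<inter> C) \<subseteq> C"
        using clC by (simp add: closure_of_minimal)
    qed
    then have "c \<in> h ` S"
      using skula[OF cY] c cC by simp
    then obtain s where s: "s \<in> S" "c = h s"
      by blast
    have "s \<in> K" if K: "K \<in> \<K>" for K
    proof -
      obtain k where k: "k \<in> K" "h k \<in> Y closure_of {h s}"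
        using below[OF K] s by blast
      obtain \<U> where \<U>: "\<forall>O'\<in>\<U>. openin ?W O'" "K = topspace ?W \<inter> \<Inter>\<U>"
        using K KW by (auto simp: compact_saturated_sets_def saturatedin_def)
      have "s \<in> O'" if O': "O' \<in> \<U>" for O'
      proof -
        obtain P where "openin Y P" "O' = h -` P \<inter> S"
          using \<U> O' by (auto simp: openin_pullback_topology)
        then show ?thesis
          using k s \<U> O' by (auto simp: in_closure_of_sing)
      qed
      then show ?thesis
        using \<U> s topW by auto
    qed
    then have "s \<in> U"
      using int by blast
    then show False
      using V s c C by auto
  qed
  ultimately show ?thesis
    unfolding well_filtered_space_def by blast
qed

theorem WD_universal:
  fixes X :: "'a topology" and Y :: "'b topology"
  assumes A: "A \<in> WD X" and Y: "well_filtered_space Y" and f: "continuous_map X Y f"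
  shows "\<exists>!y. y \<in> topspace Y \<and> Y closure_of (f ` A) = Y closure_of {y}"
proof -
  define g where "g y = {x \<in> topspace X. f x \<in> Y closure_of {y}}" for y
  define Z where "Z = {y \<in> topspace Y. y \<in> Y closure_of (f ` g y)}"
  define h where "h = inv_into Z g"
  let ?W = "pullback_topology (g ` Z) h Y"
  have t0: "t0_space Y"
    using Y by (simp add: well_filtered_space_def)
  have fY: "f x \<in> topspace Y" if "x \<in> topspace X" for x
    using f that by (auto simp: continuous_map_def)
  have clZ: "Y closure_of {y} = Y closure_of (f ` g y)" if "y \<in> Z" for y
  proof
    show "Y closure_of {y} \<subseteq> Y closure_of (f ` g y)"
      using that by (simp add: Z_def closure_of_minimal)
    show "Y closure_of (f ` g y) \<subseteq> Y closure_of {y}"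
      by (rule closure_of_minimal) (auto simp: g_def)
  qed
  have inj: "inj_on g Z"
  proof (rule inj_onI)
    fix y z assume yz: "y \<in> Z" "z \<in> Z" "g y = g z"
    then have "Y closure_of {y} = Y closure_of {z}"
      by (simp add: clZ)
    then show "y = z"
      using t0 yz by (simp add: t0_space_closure_of_sing Z_def)
  qed
  have hg: "h (g y) = y" if "y \<in> Z" for y
    using inj that by (simp add: h_def)
  have hS: "h ` g ` Z = Z"
    using hg by force
  have ZY: "Z \<subseteq> topspace Y"
    by (auto simp: Z_def)
  have fZ: "f x \<in> Z" if "x \<in> topspace X" for x
  proof -
    have "f x \<in> f ` g (f x)"
      using that fY by (auto simp: g_def in_closure_of_sing)
    moreover have "f ` g (f x) \<subseteq> topspace Y"
      using fY by (auto simp: g_def)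
    ultimately show ?thesis
      using closure_of_subset that fY by (fastforce simp: Z_def)
  qed
  have W: "well_filtered_space ?W"
  proof (rule well_filtered_space_pullback[OF Y])
    show "h ` g ` Z \<subseteq> topspace Y"
      using hS ZY by simp
    show "inj_on h (g ` Z)"
      by (simp add: h_def inj_on_inv_into)
    fix y assume y: "y \<in> topspace Y" "y \<in> Y closure_of (h ` g ` Z \<inter> Y closure_of {y})"
    have "Z \<inter> Y closure_of {y} \<subseteq> Y closure_of (f ` g y)"
    proof
      fix z assume z: "z \<in> Z \<inter> Y closure_of {y}"
      have "Y closure_of {z} \<subseteq> Y closure_of {y}"
        using z by (simp add: closure_of_minimal)
      then have "g z \<subseteq> g y"
        by (auto simp: g_def)
      then have "Y closure_of (f ` g z) \<subseteq> Y closure_of (f ` g y)"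
        by (intro closure_of_mono image_mono)
      then show "z \<in> Y closure_of (f ` g y)"
        using z by (auto simp: Z_def)
    qed
    then have "Y closure_of (Z \<inter> Y closure_of {y}) \<subseteq> Y closure_of (f ` g y)"
      by (simp add: closure_of_minimal)
    then show "y \<in> h ` g ` Z"
      using y hS by (auto simp: Z_def)
  qed
  have topW: "topspace ?W = g ` Z"
    using hS ZY by (auto simp: topspace_pullback_topology)
  have contW: "continuous_map X ?W (\<lambda>x. g (f x))"
    unfolding continuous_map_def
  proof (intro conjI allI impI)
    show "(\<lambda>x. g (f x)) \<in> topspace X \<rightarrow> topspace ?W"
      using fZ topW by auto
    fix U assume "openin ?W U"
    then obtain V where V: "openin Y V" "U = h -` V \<inter> g ` Z"
      by (auto simp: openin_pullback_topology)
    then have "{x \<in> topspace X. g (f x) \<in> U} = {x \<in> topspace X. f x \<in> V}"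
      using fZ hg by auto
    then show "openin X {x \<in> topspace X. g (f x) \<in> U}"
      using f V by (auto simp: continuous_map_def)
  qed
  have AX: "A \<subseteq> topspace X"
    using A closedin_subset by (auto simp: WD_def)
  have clW: "g z \<in> ?W closure_of (g ` B) \<longleftrightarrow> z \<in> Y closure_of B" if "z \<in> Z" "B \<subseteq> Z" for z B
  proof
    assume L: "g z \<in> ?W closure_of (g ` B)"
    show "z \<in> Y closure_of B"
      unfolding in_closure_of
    proof (intro conjI allI impI)
      show "z \<in> topspace Y"
        using that ZY by blast
      fix T assume T: "z \<in> T \<and> openin Y T"
      then have "openin ?W (h -` T \<inter> g ` Z)" "g z \<in> h -` T \<inter> g ` Z"
        using that hg by (auto simp: openin_pullback_topology)
      then have "\<exists>w. w \<in> g ` B \<and> w \<in> h -` T \<inter> g ` Z"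
        using L[unfolded in_closure_of, THEN conjunct2, rule_format, of "h -` T \<inter> g ` Z"] by simp
      then obtain w where "w \<in> g ` B" "w \<in> h -` T \<inter> g ` Z"
        by (elim exE conjE)
      then obtain b where "b \<in> B" "h (g b) \<in> T"
        by blast
      then show "\<exists>y. y \<in> B \<and> y \<in> T"
        using hg[of b] subsetD[OF that(2), of b] by (intro exI[of _ b]) simp
    qed
  next
    assume R: "z \<in> Y closure_of B"
    show "g z \<in> ?W closure_of (g ` B)"
      unfolding in_closure_of
    proof (intro conjI allI impI)
      show "g z \<in> topspace ?W"
        using that topW by blast
      fix T assume T: "g z \<in> T \<and> openin ?W T"
      then obtain V where V: "openin Y V" "T = h -` V \<inter> g ` Z"
        by (auto simp: openin_pullback_topology)
      then have "z \<in> V"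
        using T that(1) hg[of z] by simp
      then obtain b where "b \<in> B" "b \<in> V"
        using R[unfolded in_closure_of, THEN conjunct2, rule_format, of V] V(1) by auto
      moreover have "g b \<in> T"
        using \<open>b \<in> B\<close> \<open>b \<in> V\<close> V(2) subsetD[OF that(2), of b] hg[of b] by simp
      ultimately show "\<exists>y. y \<in> g ` B \<and> y \<in> T"
        by blast
    qed
  qed
  obtain w where w: "w \<in> topspace ?W" "?W closure_of ((\<lambda>x. g (f x)) ` A) = ?W closure_of {w}"
    using A W contW unfolding WD_def by blast
  then obtain y where y: "y \<in> Z" "w = g y"
    using topW by blast
  have fAZ: "f ` A \<subseteq> Z"
    using AX fZ by blast
  have eq: "?W closure_of (g ` f ` A) = ?W closure_of (g ` {y})"
    using w y by (simp add: image_image)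
  have "Y closure_of (f ` A) = Y closure_of {y}"
  proof
    have "z \<in> Y closure_of {y}" if "z \<in> f ` A" for z
    proof -
      have "z \<in> Z" "z \<in> Y closure_of (f ` A)"
        using that fAZ ZY closure_of_subset[of "f ` A" Y] by auto
      then show ?thesis
        using clW[of z "f ` A"] clW[of z "{y}"] eq fAZ y by simp
    qed
    then show "Y closure_of (f ` A) \<subseteq> Y closure_of {y}"
      by (intro closure_of_minimal) auto
    have "y \<in> Y closure_of {y}"
      using y ZY by (auto simp: in_closure_of_sing)
    then have "y \<in> Y closure_of (f ` A)"
      using clW[of y "f ` A"] clW[of y "{y}"] eq fAZ y by simp
    then show "Y closure_of {y} \<subseteq> Y closure_of (f ` A)"
      by (simp add: closure_of_minimal)
  qed
  moreover have "y \<in> topspace Y"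
    using y ZY by blast
  ultimately show ?thesis
    using t0 by (intro ex1I[of _ y]) (auto simp: t0_space_closure_of_sing)
qed

end

theory Submission
  imports Defs
begin

text \<open>
  Point closures always belong to \<open>RD X\<close>, and \<open>RD X \<subseteq> WD X\<close> (\<open>RD_subset_WD\<close>), so the three
  conditions are linked by the chain \<open>point_closures X \<subseteq> RD X \<subseteq> WD X\<close>.

  If \<open>X\<close> is well-filtered, then testing a member \<open>A\<close> of \<open>WD X\<close> against the identity of \<open>X\<close>
  produces a point whose closure is \<open>A\<close>; the chain collapses to equalities.  If all that is
  known is that \<open>WD X\<close> consists of point closures, then so does the smaller \<open>RD X\<close>.  Finally, suppose
  that \<open>RD X\<close> consists of point closures and that no member of a filtered family \<open>\<K>\<close> lies in an
  open set \<open>U\<close>.  Then the complement of \<open>U\<close> meets every member of \<open>\<K>\<close>, and Rudin's lemma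
  (\<open>exists_minimal_closed_meeting\<close>) shrinks it to a minimal closed set with this property.  That set
  is in \<open>RD X\<close>, hence the closure of a point \<open>x\<close>, and \<open>x\<close> lies in every member of \<open>\<K>\<close> because these are
  saturated.  So \<open>\<Inter>\<K>\<close> is not contained in \<open>U\<close>.
\<close>

lemma mem_saturatedin_if_meets_closure:
  assumes S: "saturatedin X S" and x: "x \<in> topspace X" and meet: "X closure_of {x} \<inter> S \<noteq> {}"
  shows "x \<in> S"
proof -
  obtain \<U> where \<U>: "\<forall>U\<in>\<U>. openin X U" "S = topspace X \<inter> \<Inter>\<U>"
    using S by (auto simp: saturatedin_def)
  obtain z where z: "z \<in> X closure_of {x}" "z \<in> S"
    using meet by blast
  show ?thesis
    using \<U> x z by (auto simp: in_closure_of_sing)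
qed

lemma ex1_generic_point_if_t0_space:
  assumes "t0_space Y" "y \<in> topspace Y" "C = Y closure_of {y}"
  shows "\<exists>!y. y \<in> topspace Y \<and> C = Y closure_of {y}"
  using assms by (intro ex1I[of _ y]) (auto simp: t0_space_closure_of_sing)

text \<open>
  For the point \<open>x\<close>, the one-member family consisting of the upward closure of \<open>x\<close> in the
  specialization order is a witness: a closed set meets it exactly when it contains \<open>x\<close>.
\<close>

lemma point_closures_subset_RD: "point_closures X \<subseteq> RD X"
proof
  fix A assume "A \<in> point_closures X"
  then obtain x where x: "x \<in> topspace X" and A: "A = X closure_of {x}"
    by (auto simp: point_closures_def)
  define K where "K = {y \<in> topspace X. \<exists>b\<in>{x}. b \<in> X closure_of {y}}"
  have K: "{K} \<subseteq> compact_saturated_sets X"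
    using compact_saturated_upclosure[of X "{x}"] x by (simp add: K_def)
  have xA: "x \<in> A" and xK: "x \<in> K"
    using x by (auto simp: A K_def in_closure_of_sing)
  have meet: "closed_meeting X {K} A"
    using xA xK by (auto simp: closed_meeting_def A)
  have "B = A" if B: "closed_meeting X {K} B" "B \<subseteq> A" for B
  proof
    have clB: "closedin X B"
      using B(1) by (simp add: closed_meeting_def)
    obtain b where b: "b \<in> B" "x \<in> X closure_of {b}"
      using B(1) by (auto simp: closed_meeting_def K_def)
    have "X closure_of {b} \<subseteq> B"
      using b clB by (simp add: closure_of_minimal)
    then have "x \<in> B"
      using b(2) by blast
    then show "A \<subseteq> B"
      using clB by (simp add: A closure_of_minimal)
  qed (rule B(2))
  moreover have "filtered_family {K}"
    by (simp add: filtered_family_def)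
  ultimately show "A \<in> RD X"
    using xA K meet unfolding RD_def by (auto simp: A)
qed

text \<open>
  Let \<open>A\<close> be minimal for the filtered family \<open>\<K>\<close>, and let \<open>f\<close> map into a well-filtered space.  The
  upward closures of the sets \<open>f ` (K \<inter> A)\<close> form a filtered family of compact saturated sets, and
  none of them avoids the closure of \<open>f ` A\<close>; so well-filteredness puts a point \<open>y\<close> of this closure
  into all of them.  Then every \<open>K\<close> contains a point of \<open>A\<close> that \<open>f\<close> sends into the closure of \<open>y\<close>.
  Minimality forces \<open>f\<close> to send all of \<open>A\<close> there.
\<close>

lemma RD_subset_WD: "RD X \<subseteq> WD X"
proof
  fix A assume "A \<in> RD X"
  then obtain \<K> where clA: "closedin X A" and \<K>: "\<K> \<subseteq> compact_saturated_sets X"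
    and filt: "filtered_family \<K>" and meet: "closed_meeting X \<K> A"
    and min: "\<And>B. closed_meeting X \<K> B \<Longrightarrow> B \<subseteq> A \<Longrightarrow> B = A"
    by (auto simp: RD_def)
  have AX: "A \<subseteq> topspace X"
    using clA by (rule closedin_subset)
  have "\<exists>!y. y \<in> topspace Y \<and> Y closure_of (f ` A) = Y closure_of {y}"
    if Y: "well_filtered_space Y" and f: "continuous_map X Y f" for Y :: "'a set topology" and f
  proof -
    define up where "up B = {y \<in> topspace Y. \<exists>b\<in>B. b \<in> Y closure_of {y}}" for B
    define \<G> where "\<G> = (\<lambda>K. up (f ` (K \<inter> A))) ` \<K>"
    let ?C = "Y closure_of (f ` A)"
    have fA: "f ` A \<subseteq> topspace Y"
      using f AX by (auto simp: continuous_map_def)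
    have fC: "f ` A \<subseteq> ?C"
      using fA by (rule closure_of_subset)
    have \<G>: "\<G> \<subseteq> compact_saturated_sets Y"
    proof -
      have "up (f ` (K \<inter> A)) \<in> compact_saturated_sets Y" if "K \<in> \<K>" for K
      proof -
        have "compactin X (K \<inter> A)" "K \<inter> A \<noteq> {}"
          using that \<K> clA meet
          by (auto simp: compact_saturated_sets_def closed_meeting_def compact_Int_closedin)
        then show ?thesis
          unfolding up_def using f by (intro compact_saturated_upclosure image_compactin) auto
      qed
      then show ?thesis
        by (auto simp: \<G>_def)
    qed
    have filtG: "filtered_family \<G>"
      unfolding filtered_family_def
    proof (intro conjI ballI)
      show "\<G> \<noteq> {}"
        using filt by (auto simp: \<G>_def filtered_family_def)
      fix G1 G2 assume "G1 \<in> \<G>" "G2 \<in> \<G>"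
      then obtain K1 K2 where K: "K1 \<in> \<K>" "K2 \<in> \<K>"
        "G1 = up (f ` (K1 \<inter> A))" "G2 = up (f ` (K2 \<inter> A))"
        by (auto simp: \<G>_def)
      then obtain K3 where K3: "K3 \<in> \<K>" "K3 \<subseteq> K1" "K3 \<subseteq> K2"
        using filt unfolding filtered_family_def by meson
      then have "up (f ` (K3 \<inter> A)) \<subseteq> G1 \<and> up (f ` (K3 \<inter> A)) \<subseteq> G2"
        using K by (auto simp: up_def)
      then show "\<exists>G3\<in>\<G>. G3 \<subseteq> G1 \<and> G3 \<subseteq> G2"
        using K3 by (auto simp: \<G>_def)
    qed
    have "\<not> G \<subseteq> topspace Y - ?C" if G: "G \<in> \<G>" for G
    proof -
      obtain K where K: "K \<in> \<K>" "G = up (f ` (K \<inter> A))"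
        using G by (auto simp: \<G>_def)
      obtain a where a: "a \<in> A" "a \<in> K"
        using meet K by (auto simp: closed_meeting_def)
      then have "f a \<in> G"
        using fA K by (auto simp: up_def in_closure_of_sing)
      then show ?thesis
        using a fC by blast
    qed
    moreover have "openin Y (topspace Y - ?C)"
      by (simp add: openin_diff)
    ultimately have "\<not> \<Inter>\<G> \<subseteq> topspace Y - ?C"
      using Y \<G> filtG unfolding well_filtered_space_def by blast
    moreover have "\<Inter>\<G> \<subseteq> topspace Y"
      using filt by (auto simp: \<G>_def up_def filtered_family_def)
    ultimately obtain y where y: "y \<in> \<Inter>\<G>" "y \<in> ?C"
      by blast
    have yY: "y \<in> topspace Y"
      using y(2) by (simp add: in_closure_of)
    define B where "B = A \<inter> {x \<in> topspace X. f x \<in> Y closure_of {y}}"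
    have "closedin X B"
      unfolding B_def using clA f
      by (intro closedin_Int closedin_continuous_map_preimage) auto
    moreover have "B \<inter> K \<noteq> {}" if K: "K \<in> \<K>" for K
    proof -
      have "y \<in> up (f ` (K \<inter> A))"
        using y K by (auto simp: \<G>_def)
      then show ?thesis
        using AX by (auto simp: up_def B_def)
    qed
    ultimately have "B = A"
      by (intro min) (auto simp: closed_meeting_def B_def)
    then have "f ` A \<subseteq> Y closure_of {y}"
      by (auto simp: B_def)
    then have "?C = Y closure_of {y}"
      using y by (intro equalityI closure_of_minimal) auto
    then show ?thesis
      using Y yY by (intro ex1_generic_point_if_t0_space) (auto simp: well_filtered_space_def)
  qed
  then show "A \<in> WD X"
    using clA by (simp add: WD_def)
qed

text \<open>The generic point comes from the identity map, a continuous map into a well-filtered space.\<close>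

lemma WD_subset_point_closures_if_well_filtered:
  assumes X: "well_filtered_space X"
  shows "WD X \<subseteq> point_closures X"
proof
  fix A assume A: "A \<in> WD X"
  then have "X closure_of A = A"
    by (simp add: WD_def closure_of_closedin)
  moreover have "\<exists>!x. x \<in> topspace X \<and> X closure_of (id ` A) = X closure_of {x}"
    by (rule WD_universal[OF A X]) simp
  ultimately show "A \<in> point_closures X"
    by (auto simp: point_closures_def)
qed

lemma well_filtered_if_RD_subset_point_closures:
  assumes t0: "t0_space X" and RD: "RD X \<subseteq> point_closures X"
  shows "well_filtered_space X"
proof -
  have "\<exists>K\<in>\<K>. K \<subseteq> U"
    if U: "openin X U" and \<K>: "\<K> \<subseteq> compact_saturated_sets X"
      and filt: "filtered_family \<K>" and int: "\<Inter>\<K> \<subseteq> U" for U \<K>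
  proof (rule ccontr)
    assume neg: "\<not> (\<exists>K\<in>\<K>. K \<subseteq> U)"
    have comp: "compactin X K" and sat: "saturatedin X K" if "K \<in> \<K>" for K
      using that \<K> by (auto simp: compact_saturated_sets_def)
    have D: "closed_meeting X \<K> (topspace X - U)"
      using U neg comp compactin_subset_topspace by (fastforce simp: closed_meeting_def)
    obtain C where C: "closed_meeting X \<K> C" "C \<subseteq> topspace X - U"
      and min: "\<And>B. closed_meeting X \<K> B \<Longrightarrow> B \<subseteq> C \<Longrightarrow> B = C"
      using exists_minimal_closed_meeting[OF comp D] by metis
    have "C \<noteq> {}"
      using C(1) filt by (auto simp: closed_meeting_def filtered_family_def)
    moreover have "closedin X C"
      using C(1) by (simp add: closed_meeting_def)
    moreover have "\<forall>B. closed_meeting X \<K> B \<and> B \<subseteq> C \<longrightarrow> B = C"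
      using min by blast
    ultimately have "C \<in> RD X"
      unfolding RD_def mem_Collect_eq using C(1) \<K> filt
      by (intro conjI exI[where x = \<K>])
    then obtain x where x: "x \<in> topspace X" "C = X closure_of {x}"
      using RD by (auto simp: point_closures_def)
    have "x \<in> K" if "K \<in> \<K>" for K
    proof (rule mem_saturatedin_if_meets_closure[OF sat[OF that] x(1)])
      show "X closure_of {x} \<inter> K \<noteq> {}"
        using C(1) that unfolding closed_meeting_def x(2) by blast
    qed
    then have "x \<in> U"
      using int by blast
    moreover have "x \<in> C"
      using x by (simp add: in_closure_of_sing)
    ultimately show False
      using C(2) by blast
  qed
  then show ?thesis
    using t0 unfolding well_filtered_space_def by blast
qed

theorem proposition3p1:
  fixes X :: "'a topology"
  assumes "t0_space X"
  shows "(well_filtered_space X \<longleftrightarrow> WD X = point_closures X) \<and>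
         (WD X = point_closures X \<longleftrightarrow> RD X = point_closures X)"
proof -
  have "WD X = point_closures X" if "well_filtered_space X"
    using WD_subset_point_closures_if_well_filtered[OF that]
      point_closures_subset_RD[of X] RD_subset_WD[of X] by (meson order_trans subset_antisym)
  moreover have "RD X = point_closures X" if "WD X = point_closures X"
    using that point_closures_subset_RD[of X] RD_subset_WD[of X] by simp
  moreover have "well_filtered_space X" if "RD X = point_closures X"
    using well_filtered_if_RD_subset_point_closures[OF assms] that by simp
  ultimately show ?thesis
    by argo
qed

end
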